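(* Let $n,m$ be positive integers, let $x_1<x_2<\dots<x_n$ and $y_1<y_2<\dots<y_m$ be real numbers, and let $Z=(z_{ij})\in\mathbb{R}^{n\times m}$. Put $P_{ij}:=(x_i,y_j,z_{ij})\in\mathbb{R}^3$ and define \[ A_i:=\operatorname{conv}\{P_{ij}: j\in[m]\}\quad (i\in[n]),\qquad B_j:=\operatorname{conv}\{P_{ij}: i\in[n]\}\quad (j\in[m]). \] Then either there is an $i\in[n]$ and a line contained in the plane $\{(x_i,s,t): s,t\in\mathbb{R}\}$ that intersects at least $\frac m6$ of the sets $B_1,\dots,B_m$, or there is a $j\in[m]$ and a line contained in the plane $\{(s,y_j,t): s,t\in\mathbb{R}\}$ that intersects at least $\frac n6$ of the sets $A_1,\dots,A_n$.
   Context: $[n]=\{1,\dots,n\}$. *)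

theory Defs
  imports "HOL-Analysis.Analysis"
begin

definition is_line :: "(real \<times> real \<times> real) set \<Rightarrow> bool" where
  "is_line L \<longleftrightarrow> (\<exists>p d. d \<noteq> 0 \<and> L = {p + t *\<^sub>R d | t. True})"

end

theory Submission
  imports Defs
begin

text \<open>For \<open>i1 < i2 < i3\<close> and \<open>j1 < j2 < j3\<close>, either a line in the plane of row \<open>i2\<close> meets
  \<open>B j1\<close>, \<open>B j2\<close>, \<open>B j3\<close>, or a line in the plane of column \<open>j2\<close> meets \<open>A i1\<close>, \<open>A i2\<close>, \<open>A i3\<close>.
  Otherwise the weighted second differences of \<open>z\<close> at the centre along the row and along the column
  are so large that either each exceeds the other, or the two ways of computing the mixed second
  difference disagree. Hence at every cell \<open>(i, j)\<close> one of the following holds: row \<open>i\<close> can be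
  stabbed for all column triples with middle \<open>j\<close>, or column \<open>j\<close> can be stabbed for all row triples
  with middle \<open>i\<close>. By double counting, some row or some column has the corresponding property at half
  of its cells, and Helly's theorem in the plane of non-vertical lines gives a common
  transversal of these. The constant obtained is 1/2 instead of 1/6.\<close>

section \<open>Stabbing lines as points of a plane\<close>

text \<open>The pair \<open>(a, b)\<close> stands for the line \<open>t = a * s + b\<close> in the plane of row \<open>i\<close>. Exchanging the
  roles of \<open>x\<close> and \<open>y\<close> and transposing \<open>z\<close> gives the lines in the plane of a column.\<close>

definition stabbers ::
  "nat set \<Rightarrow> (nat \<Rightarrow> real) \<Rightarrow> (nat \<Rightarrow> real) \<Rightarrow> (nat \<Rightarrow> nat \<Rightarrow> real) \<Rightarrow> nat \<Rightarrow> nat \<Rightarrow> (real \<times> real) set" where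
  "stabbers I x y z i j =
     {(a, b). (x i, a * y j + b) \<in> convex hull ((\<lambda>k. (x k, z k j)) ` I)}"

text \<open>For fixed \<open>i\<close> and \<open>j\<close> the map from \<open>(a, b)\<close> to
  \<open>(x i, a * y j + b)\<close> is affine, so this set is the preimage of a convex hull. Helly's
  theorem needs this convexity.\<close>

lemma convex_stabbers: "convex (stabbers I x y z i j)"
proof -
  let ?H = "convex hull ((\<lambda>k. (x k, z k j)) ` I)"
  have "(x i, (u * fst p + v * fst q) * y j + (u * snd p + v * snd q)) \<in> ?H"
    if "p \<in> stabbers I x y z i j" "q \<in> stabbers I x y z i j"
      and uv: "0 \<le> u" "0 \<le> v" "u + v = 1" for p q u v
  proof -
    have "(x i, fst p * y j + snd p) \<in> ?H" "(x i, fst q * y j + snd q) \<in> ?H"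
      using that by (auto simp: stabbers_def)
    from convexD[OF convex_convex_hull this uv]
    have "(u * x i + v * x i, u * (fst p * y j + snd p) + v * (fst q * y j + snd q)) \<in> ?H"
      by simp
    moreover have "u * x i + v * x i = x i"
      using uv by (metis distrib_right mult_1)
    ultimately show ?thesis by (simp add: algebra_simps)
  qed
  then show ?thesis
    by (intro convexI) (simp add: stabbers_def case_prod_beta)
qed

section \<open>Intervals and affine interpolation\<close>

text \<open>The averages \<open>u * a1 + v * a3\<close> range over the interval from
  \<open>L\<close> to \<open>H\<close>; \<open>lo\<close> and \<open>hi\<close> say that it meets
  \<open>{l2..h2}\<close>. One parameter \<open>t\<close>, shared by both outer intervals, realises
  a point of the overlap.\<close>

lemma interval_transversal:
  fixes l1 h1 l2 h2 l3 h3 u v :: real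
  assumes "l1 \<le> h1" "l2 \<le> h2" "l3 \<le> h3" "0 \<le> u" "0 \<le> v"
    and lo: "u * l1 + v * l3 \<le> h2" and hi: "l2 \<le> u * h1 + v * h3"
  obtains a1 a2 a3 where "a1 \<in> {l1..h1}" "a2 \<in> {l2..h2}" "a3 \<in> {l3..h3}"
    "a2 = u * a1 + v * a3"
proof -
  define L where "L = u * l1 + v * l3"
  define H where "H = u * h1 + v * h3"
  define c where "c = max l2 L"
  have "L \<le> H" unfolding L_def H_def using assms by (intro add_mono mult_left_mono)
  then have c: "L \<le> c" "c \<le> H" "l2 \<le> c" "c \<le> h2"
    using assms unfolding c_def L_def[symmetric] H_def[symmetric] by auto
  obtain t where t: "0 \<le> t" "t \<le> 1" "c = (1 - t) * L + t * H"
  proof -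
    have "c \<in> closed_segment L H" using c by (simp add: closed_segment_eq_real_ivl)
    then show thesis using that by (auto simp: in_segment)
  qed
  have *: "(1 - t) * l + t * h \<in> {l..h}" if "l \<le> h" for l h :: real
  proof -
    have "t * (h - l) \<ge> 0" "(1 - t) * (h - l) \<ge> 0" using that t by auto
    then show ?thesis by (simp add: algebra_simps)
  qed
  show thesis
  proof
    show "c = u * ((1 - t) * l1 + t * h1) + v * ((1 - t) * l3 + t * h3)"
      unfolding t(3) L_def H_def by (simp add: algebra_simps)
  qed (use * assms c in auto)
qed

lemma affine_through_two_points:
  fixes s t p q :: real
  assumes "s \<noteq> t"
  obtains a b where "a * s + b = p" "a * t + b = q"
proof -
  define a where "a = (q - p) / (t - s)"
  have "a * (t - s) = q - p" using assms by (simp add: a_def)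
  then show thesis by (intro that[of a "p - a * s"]) (simp_all add: algebra_simps)
qed

lemma convex_weights:
  fixes s t r :: real
  assumes "s < t" "t < r"
  obtains u v where "0 \<le> u" "0 \<le> v" "u + v = 1" "t = u * s + v * r"
proof -
  have "t \<in> closed_segment s r" using assms by (simp add: closed_segment_eq_real_ivl)
  then obtain v where "0 \<le> v" "v \<le> 1" "t = (1 - v) * s + v * r"
    by (auto simp: in_segment)
  then show thesis by (intro that[of "1 - v" v]) auto
qed

section \<open>The three-by-three configuration\<close>

text \<open>Above \<open>x i2\<close>, the hull of column \<open>j\<close> contains the vertical
  segment between \<open>z i2 j\<close> and the chord height \<open>z i2 j + E j\<close>.
  \<open>lo\<close> and \<open>hi\<close> are the overlap conditions of
  \<open>interval_transversal\<close> for the three segments.\<close>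

lemma stabbers_triple_nonempty:
  fixes z :: "nat \<Rightarrow> nat \<Rightarrow> real"
  assumes I: "i1 \<in> I" "i2 \<in> I" "i3 \<in> I"
    and l: "0 \<le> l1" "0 \<le> l3" "l1 + l3 = 1" "x i2 = l1 * x i1 + l3 * x i3"
    and u: "0 \<le> u1" "0 \<le> u3" "u1 + u3 = 1" "y j2 = u1 * y j1 + u3 * y j3" "y j1 \<noteq> y j3"
  defines "E \<equiv> \<lambda>j. l1 * z i1 j + l3 * z i3 j - z i2 j"
    and "D \<equiv> u1 * z i2 j1 + u3 * z i2 j3 - z i2 j2"
  assumes lo: "D \<le> u1 * max 0 (- E j1) + u3 * max 0 (- E j3) + max 0 (E j2)"
    and hi: "- D \<le> u1 * max 0 (E j1) + u3 * max 0 (E j3) + max 0 (- E j2)"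
  shows "stabbers I x y z i2 j1 \<inter> stabbers I x y z i2 j2 \<inter> stabbers I x y z i2 j3 \<noteq> {}"
proof -
  \<comment> \<open>At most one of the two maxima is nonzero, so the interval is that segment
    whatever the sign of \<open>E j\<close>.\<close>
  have hull: "(x i2, a) \<in> convex hull ((\<lambda>k. (x k, z k j)) ` I)"
    if a: "a \<in> {z i2 j - max 0 (- E j) .. z i2 j + max 0 (E j)}" for a j
  proof -
    let ?H = "convex hull ((\<lambda>k. (x k, z k j)) ` I)"
    have P: "(x k, z k j) \<in> ?H" if "k \<in> I" for k
      using that by (simp add: hull_inc)
    have "l1 *\<^sub>R (x i1, z i1 j) + l3 *\<^sub>R (x i3, z i3 j) \<in> ?H"
      using l I P by (intro convexD) auto
    then have Q: "(x i2, z i2 j + E j) \<in> ?H"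
      using l by (simp add: E_def)
    have "a \<in> closed_segment (z i2 j) (z i2 j + E j)"
      using a by (auto simp: closed_segment_eq_real_ivl max_def split: if_splits)
    then obtain t where t: "0 \<le> t" "t \<le> 1" "a = (1 - t) * z i2 j + t * (z i2 j + E j)"
      by (auto simp: in_segment)
    have "(1 - t) *\<^sub>R (x i2, z i2 j) + t *\<^sub>R (x i2, z i2 j + E j) \<in> ?H"
      using t P[OF I(2)] Q by (intro convexD) auto
    then show ?thesis by (simp add: t(3) algebra_simps)
  qed
  have le: "z i2 j - max 0 (- E j) \<le> z i2 j + max 0 (E j)" for j by simp
  have lo': "u1 * (z i2 j1 - max 0 (- E j1)) + u3 * (z i2 j3 - max 0 (- E j3)) \<le> z i2 j2 + max 0 (E j2)"
    using lo unfolding D_def right_diff_distrib by linarith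
  have hi': "z i2 j2 - max 0 (- E j2) \<le> u1 * (z i2 j1 + max 0 (E j1)) + u3 * (z i2 j3 + max 0 (E j3))"
    using hi unfolding D_def distrib_left by linarith
  obtain a1 a2 a3 where
      a: "a1 \<in> {z i2 j1 - max 0 (- E j1) .. z i2 j1 + max 0 (E j1)}"
         "a2 \<in> {z i2 j2 - max 0 (- E j2) .. z i2 j2 + max 0 (E j2)}"
         "a3 \<in> {z i2 j3 - max 0 (- E j3) .. z i2 j3 + max 0 (E j3)}"
      and a2: "a2 = u1 * a1 + u3 * a3"
    using interval_transversal[OF le le le u(1,2) lo' hi'] .
  obtain c d where cd: "c * y j1 + d = a1" "c * y j3 + d = a3"
    using affine_through_two_points[OF u(5)] .
  have "c * y j2 + d = u1 * (c * y j1 + d) + u3 * (c * y j3 + d)"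
  proof -
    have "d = (u1 + u3) * d" using u by simp
    then show ?thesis unfolding u(4) by (simp add: algebra_simps)
  qed
  with cd a2 have "c * y j2 + d = a2" by simp
  with cd hull a have "(c, d) \<in> stabbers I x y z i2 j1 \<inter> stabbers I x y z i2 j2 \<inter> stabbers I x y z i2 j3"
    by (simp add: stabbers_def)
  then show ?thesis by blast
qed

lemma stabbers_three_by_three:
  assumes I: "i1 \<in> I" "i2 \<in> I" "i3 \<in> I" and J: "j1 \<in> J" "j2 \<in> J" "j3 \<in> J"
    and x: "x i1 < x i2" "x i2 < x i3" and y: "y j1 < y j2" "y j2 < y j3"
  shows "stabbers I x y z i2 j1 \<inter> stabbers I x y z i2 j2 \<inter> stabbers I x y z i2 j3 \<noteq> {} \<or>
    stabbers J y x (\<lambda>j i. z i j) j2 i1 \<inter> stabbers J y x (\<lambda>j i. z i j) j2 i2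
      \<inter> stabbers J y x (\<lambda>j i. z i j) j2 i3 \<noteq> {}"
proof (rule ccontr)
  assume no: "\<not> ?thesis"
  obtain l1 l3 where l: "0 \<le> l1" "0 \<le> l3" "l1 + l3 = 1" "x i2 = l1 * x i1 + l3 * x i3"
    using convex_weights[OF x] .
  obtain u1 u3 where u: "0 \<le> u1" "0 \<le> u3" "u1 + u3 = 1" "y j2 = u1 * y j1 + u3 * y j3"
    using convex_weights[OF y] .
  define E where "E = (\<lambda>j. l1 * z i1 j + l3 * z i3 j - z i2 j)"
  define D where "D = (\<lambda>i. u1 * z i j1 + u3 * z i j3 - z i j2)"
  \<comment> \<open>Both sides are the mixed second difference of \<open>z\<close> on the grid,
    taken in the two possible orders.\<close>
  have mixed: "l1 * D i1 - D i2 + l3 * D i3 = u1 * E j1 - E j2 + u3 * E j3"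
    by (simp add: D_def E_def algebra_simps)
  have row: "u1 * max 0 (- E j1) + u3 * max 0 (- E j3) + max 0 (E j2) < D i2 \<or>
      u1 * max 0 (E j1) + u3 * max 0 (E j3) + max 0 (- E j2) < - D i2"
    (is "?a < ?d \<or> ?b < - ?d")
  proof (rule ccontr)
    assume "\<not> ?thesis"
    then have "?d \<le> ?a" "- ?d \<le> ?b" by (simp_all only: de_Morgan_disj not_less)
    moreover have "y j1 \<noteq> y j3" using y by simp
    ultimately show False
      using stabbers_triple_nonempty[OF I l u, where z = z] no unfolding E_def D_def by blast
  qed
  have col: "l1 * max 0 (- D i1) + l3 * max 0 (- D i3) + max 0 (D i2) < E j2 \<or>
      l1 * max 0 (D i1) + l3 * max 0 (D i3) + max 0 (- D i2) < - E j2"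
    (is "?a < ?e \<or> ?b < - ?e")
  proof (rule ccontr)
    assume "\<not> ?thesis"
    then have "?e \<le> ?a" "- ?e \<le> ?b" by (simp_all only: de_Morgan_disj not_less)
    moreover have "x i1 \<noteq> x i3" using x by simp
    ultimately show False
      using stabbers_triple_nonempty[OF J u l, where z = "\<lambda>j i. z i j"] no
      unfolding E_def D_def by blast
  qed
  have weighted: "0 \<le> c * max 0 s + d * max 0 t" "c * s + d * t \<le> c * max 0 s + d * max 0 t"
    if "0 \<le> c" "0 \<le> d" for c d s t :: real
    using that by (auto intro!: add_nonneg_nonneg add_mono mult_left_mono)
  \<comment> \<open>If \<open>d2\<close> and \<open>e2\<close> have the same sign, each exceeds the
    other in absolute value. If the signs differ, \<open>U + d2\<close> and \<open>W + e2\<close>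
    have opposite strict signs, yet the last equation makes them equal.\<close>
  have contradiction: False
    if "a + e < d2 \<or> a' + e' < - d2" "b + f < e2 \<or> b' + f' < - e2"
      "0 \<le> a" "- U \<le> a" "0 \<le> a'" "U \<le> a'" "0 \<le> b" "- W \<le> b" "0 \<le> b'" "W \<le> b'"
      "0 \<le> e" "e2 \<le> e" "0 \<le> e'" "- e2 \<le> e'" "0 \<le> f" "d2 \<le> f" "0 \<le> f'" "- d2 \<le> f'"
      "W - d2 = U - e2" for a a' b b' d2 e e' e2 f f' U W :: real
    using that by linarith
  show False
  proof (rule contradiction[OF row col])
    show "(l1 * D i1 + l3 * D i3) - D i2 = (u1 * E j1 + u3 * E j3) - E j2"
      using mixed by simp
    show "- (u1 * E j1 + u3 * E j3) \<le> u1 * max 0 (- E j1) + u3 * max 0 (- E j3)"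
      using weighted(2)[OF u(1,2), of "- E j1" "- E j3"] by simp
    show "- (l1 * D i1 + l3 * D i3) \<le> l1 * max 0 (- D i1) + l3 * max 0 (- D i3)"
      using weighted(2)[OF l(1,2), of "- D i1" "- D i3"] by simp
  qed (simp_all only: weighted l u max.cobounded1 max.cobounded2)
qed

section \<open>Helly's theorem and common transversals\<close>

text \<open>\<open>Helly\<close> speaks of at least three distinct sets, but different indices may
  give the same set. With at most two distinct sets, a triple with a repeated index already yields a
  common point.\<close>

lemma helly_plane_indexed:
  fixes S :: "'a \<Rightarrow> (real \<times> real) set"
  assumes "finite J" "J \<noteq> {}" and conv: "\<And>j. j \<in> J \<Longrightarrow> convex (S j)"
    and triple: "\<And>i j k. i \<in> J \<Longrightarrow> j \<in> J \<Longrightarrow> k \<in> J \<Longrightarrow> S i \<inter> S j \<inter> S k \<noteq> {}"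
  shows "(\<Inter>j\<in>J. S j) \<noteq> {}"
proof (cases "card (S ` J) \<ge> 3")
  case True
  show ?thesis
  proof (rule Helly)
    show "DIM(real \<times> real) + 1 \<le> card (S ` J)" using True by simp
    show "\<forall>s\<in>S ` J. convex s" using conv by auto
    fix t assume t: "t \<subseteq> S ` J" "card t = DIM(real \<times> real) + 1"
    then have "card t = 3" by simp
    then obtain A B C where "t = {A, B, C}" by (auto simp: card_3_iff)
    with t(1) obtain i j k where "i \<in> J" "j \<in> J" "k \<in> J" "t = {S i, S j, S k}" by auto
    with triple[of i j k] show "\<Inter>t \<noteq> {}" by (simp add: Int_assoc)
  qed
next
  case False
  obtain i where i: "i \<in> J" using \<open>J \<noteq> {}\<close> by auto
  define M where "M = S ` J - {S i}"
  have "card M \<le> Suc 0" "finite M" using False i \<open>finite J\<close> by (simp_all add: M_def)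
  then have eq: "a = b" if "a \<in> M" "b \<in> M" for a b
    using that card_le_Suc0_iff_eq[of M] by blast
  obtain k where k: "k \<in> J" "\<And>l. l \<in> J \<Longrightarrow> S l = S i \<or> S l = S k"
  proof (cases "\<exists>k\<in>J. S k \<noteq> S i")
    case True
    then obtain k where k: "k \<in> J" "S k \<noteq> S i" by auto
    then have "S l = S i \<or> S l = S k" if "l \<in> J" for l
      using eq[of "S l" "S k"] that by (auto simp: M_def)
    with k(1) show thesis by (rule that)
  qed (use i that in blast)
  obtain p where p: "p \<in> S i" "p \<in> S k" using triple[OF i i k(1)] by auto
  have "p \<in> S l" if "l \<in> J" for l
    using k(2)[OF that] p by metis
  then show ?thesis by blast
qed

text \<open>Row \<open>i\<close> belongs to \<open>I\<close>, so its own points lie in the hulls and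
  the line through two of them stabs any pair. This settles triples with repeated indices; distinct
  ones are sorted.\<close>

lemma common_stabber:
  assumes "finite J" "J \<noteq> {}" "i \<in> I" and y: "strict_mono_on J y"
    and triple: "\<And>j1 j2 j3. j1 \<in> J \<Longrightarrow> j2 \<in> J \<Longrightarrow> j3 \<in> J \<Longrightarrow> j1 < j2 \<Longrightarrow> j2 < j3 \<Longrightarrow>
      stabbers I x y z i j1 \<inter> stabbers I x y z i j2 \<inter> stabbers I x y z i j3 \<noteq> {}"
  shows "(\<Inter>j\<in>J. stabbers I x y z i j) \<noteq> {}"
proof (rule helly_plane_indexed[OF assms(1,2) convex_stabbers])
  let ?S = "stabbers I x y z i"
  have P: "(x i, z i j) \<in> convex hull ((\<lambda>k. (x k, z k j)) ` I)" for j
    using \<open>i \<in> I\<close> by (simp add: hull_inc)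
  have pair: "?S j \<inter> ?S k \<noteq> {}" if "j \<in> J" "k \<in> J" for j k
  proof (cases "j = k")
    case True
    have "(0, z i j) \<in> ?S j" using P by (simp add: stabbers_def)
    with True show ?thesis by blast
  next
    case False
    then have "y j \<noteq> y k" using strict_mono_on_imp_inj_on[OF y] that by (auto dest: inj_onD)
    from affine_through_two_points[OF this, of "z i j" "z i k"]
    obtain a b where "a * y j + b = z i j" "a * y k + b = z i k" .
    then have "(a, b) \<in> ?S j \<inter> ?S k" using P by (simp add: stabbers_def)
    then show ?thesis by blast
  qed
  fix j k l assume jkl: "j \<in> J" "k \<in> J" "l \<in> J"
  consider "j = k" | "k = l" | "j = l" | "j < k" "k < l" | "j < l" "l < k" | "k < j" "j < l"
    | "k < l" "l < j" | "l < j" "j < k" | "l < k" "k < j"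
    by (metis linorder_neqE_nat)
  then show "?S j \<inter> ?S k \<inter> ?S l \<noteq> {}"
  proof cases
    case 1 then show ?thesis using pair[OF jkl(1,3)] by blast
  next case 2 then show ?thesis using pair[OF jkl(1,3)] by blast
  next case 3 then show ?thesis using pair[OF jkl(1,2)] by blast
  next case 4 then show ?thesis using triple[OF jkl(1,2,3)] by blast
  next case 5 then show ?thesis using triple[OF jkl(1,3,2)] by blast
  next case 6 then show ?thesis using triple[OF jkl(2,1,3)] by blast
  next case 7 then show ?thesis using triple[OF jkl(2,3,1)] by blast
  next case 8 then show ?thesis using triple[OF jkl(3,1,2)] by blast
  next case 9 then show ?thesis using triple[OF jkl(3,2,1)] by blast
  qed
qed

section \<open>Counting cells\<close>

text \<open>Otherwise fewer than half of all cells satisfy \<open>R\<close>, counted by rows, and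
  fewer than half violate it, counted by columns.\<close>

lemma row_or_column_majority:
  assumes "finite I" "finite J" "I \<noteq> {}" "J \<noteq> {}"
  shows "(\<exists>i\<in>I. card J \<le> 2 * card {j \<in> J. R i j}) \<or> (\<exists>j\<in>J. card I \<le> 2 * card {i \<in> I. \<not> R i j})"
proof (rule ccontr)
  assume "\<not> ?thesis"
  then have r: "\<And>i. i \<in> I \<Longrightarrow> 2 * card {j \<in> J. R i j} < card J"
    and c: "\<And>j. j \<in> J \<Longrightarrow> 2 * card {i \<in> I. \<not> R i j} < card I" by (auto simp: not_le)
  have "(\<Sum>i\<in>I. 2 * card {j \<in> J. R i j}) < (\<Sum>i\<in>I. card J)"
    using assms r by (intro sum_strict_mono) auto
  moreover have "(\<Sum>j\<in>J. 2 * card {i \<in> I. \<not> R i j}) < (\<Sum>j\<in>J. card I)"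
    using assms c by (intro sum_strict_mono) auto
  moreover have "(\<Sum>j\<in>J. card {i \<in> I. \<not> R i j}) = (\<Sum>i\<in>I. card {j \<in> J. \<not> R i j})"
    using assms by (intro sum_multicount_gen) auto
  moreover have "card {j \<in> J. R i j} + card {j \<in> J. \<not> R i j} = card J" for i
    using assms by (subst card_Un_disjoint[symmetric]) (auto intro!: arg_cong[where f = card])
  then have "(\<Sum>i\<in>I. card {j \<in> J. R i j}) + (\<Sum>i\<in>I. card {j \<in> J. \<not> R i j}) = card I * card J"
    by (simp flip: sum.distrib)
  ultimately show False by (simp add: mult.commute flip: sum_distrib_left)
qed

lemma majority_stabber:
  assumes fin: "finite I" "finite J" "I \<noteq> {}" "J \<noteq> {}"
    and x: "strict_mono_on I x" and y: "strict_mono_on J y"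
  shows "(\<exists>i\<in>I. \<exists>K\<subseteq>J. card J \<le> 2 * card K \<and> (\<Inter>j\<in>K. stabbers I x y z i j) \<noteq> {}) \<or>
    (\<exists>j\<in>J. \<exists>K\<subseteq>I. card I \<le> 2 * card K \<and> (\<Inter>i\<in>K. stabbers J y x (\<lambda>j i. z i j) j i) \<noteq> {})"
proof -
  let ?S = "\<lambda>i j. stabbers I x y z i j" and ?T = "\<lambda>j i. stabbers J y x (\<lambda>j i. z i j) j i"
  define R where "R i j \<longleftrightarrow> (\<forall>j1\<in>J. \<forall>j3\<in>J. j1 < j \<longrightarrow> j < j3 \<longrightarrow> ?S i j1 \<inter> ?S i j \<inter> ?S i j3 \<noteq> {})"
    for i j
  \<comment> \<open>One failing pair \<open>j1\<close>, \<open>j3\<close> excludes the row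
    alternative of the three-by-three lemma, which leaves the column alternative for all
    \<open>i1\<close>, \<open>i3\<close> around \<open>i\<close>.\<close>
  have C: "?T j i1 \<inter> ?T j i \<inter> ?T j i3 \<noteq> {}"
    if "\<not> R i j" "i \<in> I" "j \<in> J" "i1 \<in> I" "i3 \<in> I" "i1 < i" "i < i3" for i j i1 i3
  proof -
    obtain j1 j3 where j: "j1 \<in> J" "j3 \<in> J" "j1 < j" "j < j3" "?S i j1 \<inter> ?S i j \<inter> ?S i j3 = {}"
      using \<open>\<not> R i j\<close> unfolding R_def by blast
    have "x i1 < x i" "x i < x i3" "y j1 < y j" "y j < y j3"
      using that j x y by (auto dest: strict_mono_onD)
    from stabbers_three_by_three[OF that(4,2,5) j(1) that(3) j(2) this, of z] j(5)
    show ?thesis by blast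
  qed
  have nonempty: "K \<noteq> {}" if "card M \<le> 2 * card K" "finite M" "M \<noteq> {}" for K M :: "nat set"
    using that by auto
  from row_or_column_majority[OF fin, of R] show ?thesis
  proof (elim disjE bexE)
    fix i assume i: "i \<in> I" "card J \<le> 2 * card {j \<in> J. R i j}"
    have "(\<Inter>j\<in>{j \<in> J. R i j}. ?S i j) \<noteq> {}"
    proof (rule common_stabber)
      show "finite {j \<in> J. R i j}" "i \<in> I" using fin i by auto
      show "{j \<in> J. R i j} \<noteq> {}" using nonempty[OF i(2)] fin by fast
      show "strict_mono_on {j \<in> J. R i j} y" by (rule monotone_on_subset[OF y]) auto
      \<comment> \<open>The middle index supplies this: \<open>R i j2\<close> covers all outer
        indices in \<open>J\<close>.\<close>
      show "?S i j1 \<inter> ?S i j2 \<inter> ?S i j3 \<noteq> {}"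
        if "j1 \<in> {j \<in> J. R i j}" "j2 \<in> {j \<in> J. R i j}" "j3 \<in> {j \<in> J. R i j}" "j1 < j2" "j2 < j3"
        for j1 j2 j3
        using that unfolding R_def by blast
    qed
    with i show ?thesis
      by (intro disjI1 bexI[of _ i] exI[of _ "{j \<in> J. R i j}"] conjI) auto
  next
    fix j assume j: "j \<in> J" "card I \<le> 2 * card {i \<in> I. \<not> R i j}"
    have "(\<Inter>i\<in>{i \<in> I. \<not> R i j}. ?T j i) \<noteq> {}"
    proof (rule common_stabber)
      show "finite {i \<in> I. \<not> R i j}" "j \<in> J" using fin j by auto
      show "{i \<in> I. \<not> R i j} \<noteq> {}" using nonempty[OF j(2)] fin by fast
      show "strict_mono_on {i \<in> I. \<not> R i j} x" by (rule monotone_on_subset[OF x]) auto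
      show "?T j i1 \<inter> ?T j i2 \<inter> ?T j i3 \<noteq> {}"
        if "i1 \<in> {i \<in> I. \<not> R i j}" "i2 \<in> {i \<in> I. \<not> R i j}" "i3 \<in> {i \<in> I. \<not> R i j}" "i1 < i2" "i2 < i3"
        for i1 i2 i3
        using that j by (intro C) auto
    qed
    with j show ?thesis
      by (intro disjI2 bexI[of _ j] exI[of _ "{i \<in> I. \<not> R i j}"] conjI) auto
  qed
qed

section \<open>Transfer to three-dimensional space\<close>

lemma convex_hull_linear_lift:
  assumes "linear f" "p \<in> convex hull (g ` I)"
  shows "f p \<in> convex hull ((\<lambda>k. f (g k)) ` I)"
  using convex_hull_linear_image[OF assms(1), of "g ` I"] assms(2)
  by (auto simp: image_image)

theorem theorem2:
  fixes n m :: nat and x y :: "nat \<Rightarrow> real" and z :: "nat \<Rightarrow> nat \<Rightarrow> real"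
  assumes "n > 0" and "m > 0"
    and "strict_mono_on {1..n} x" and "strict_mono_on {1..m} y"
  defines "P \<equiv> (\<lambda>i j. (x i, y j, z i j))"
  defines "A \<equiv> (\<lambda>i. convex hull {P i j | j. j \<in> {1..m}})"
  defines "B \<equiv> (\<lambda>j. convex hull {P i j | i. i \<in> {1..n}})"
  shows "(\<exists>i\<in>{1..n}. \<exists>L. is_line L \<and> L \<subseteq> {(x i, s, t) | s t. True} \<and>
            real (card {j \<in> {1..m}. B j \<inter> L \<noteq> {}}) \<ge> real m / 6)
       \<or> (\<exists>j\<in>{1..m}. \<exists>L. is_line L \<and> L \<subseteq> {(s, y j, t) | s t. True} \<and>
            real (card {i \<in> {1..n}. A i \<inter> L \<noteq> {}}) \<ge> real n / 6)"
proof -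
  have count: "real (card {k \<in> {1..N}. Q k}) \<ge> real N / 6"
    if "card {1..N} \<le> 2 * card K" "K \<subseteq> {1..N}" "\<And>k. k \<in> K \<Longrightarrow> Q k" for N K Q
  proof -
    have "card K \<le> card {k \<in> {1..N}. Q k}" using that by (intro card_mono) auto
    then show ?thesis using that(1) by simp
  qed
  have B: "(x i, y j, a * y j + b) \<in> B j" if "(a, b) \<in> stabbers {1..n} x y z i j" for i j a b
  proof -
    have hull: "(x i, a * y j + b) \<in> convex hull ((\<lambda>k. (x k, z k j)) ` {1..n})"
      using that by (simp add: stabbers_def)
    \<comment> \<open>The embedding into the plane of column \<open>j\<close> is affine, so it is
      split into a linear map and a translation by \<open>(0, y j, 0)\<close>.\<close>
    have "linear (\<lambda>p::real \<times> real. (fst p, 0::real, snd p))"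
      by (intro linearI) auto
    from convex_hull_linear_lift[OF this hull]
    have "(0, y j, 0) + (x i, 0, a * y j + b) \<in>
        (\<lambda>q. (0, y j, 0) + q) ` (convex hull ((\<lambda>k. (x k, 0, z k j)) ` {1..n}))"
      by (intro imageI) simp
    then show ?thesis
      unfolding B_def P_def Setcompr_eq_image Collect_mem_eq
      by (simp add: convex_hull_translation[symmetric] image_image)
  qed
  have A: "(x i, y j, a * x i + b) \<in> A i" if "(a, b) \<in> stabbers {1..m} y x (\<lambda>j i. z i j) j i" for i j a b
  proof -
    have hull: "(y j, a * x i + b) \<in> convex hull ((\<lambda>k. (y k, z i k)) ` {1..m})"
      using that by (simp add: stabbers_def)
    have "linear (\<lambda>p::real \<times> real. (0::real, p))"
      by (intro linearI) auto
    from convex_hull_linear_lift[OF this hull]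
    have "(x i, 0, 0) + (0, y j, a * x i + b) \<in>
        (\<lambda>q. (x i, 0, 0) + q) ` (convex hull ((\<lambda>k. (0, y k, z i k)) ` {1..m}))"
      by (intro imageI) simp
    then show ?thesis
      unfolding A_def P_def Setcompr_eq_image Collect_mem_eq
      by (simp add: convex_hull_translation[symmetric] image_image)
  qed
  have "{1..n} \<noteq> {}" "{1..m} \<noteq> {}" using assms(1,2) by auto
  from majority_stabber[OF finite_atLeastAtMost finite_atLeastAtMost this assms(3,4), of z] show ?thesis
  proof (elim disjE bexE exE conjE, goal_cases)
    case (1 i K)
    then obtain a b where ab: "\<And>j. j \<in> K \<Longrightarrow> (a, b) \<in> stabbers {1..n} x y z i j" by fast
    \<comment> \<open>The parameter is the second coordinate, so \<open>t = y j\<close> gives the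
      point in \<open>B j\<close>.\<close>
    define L where "L = {(x i, 0::real, b) + t *\<^sub>R (0, 1, a) | t. True}"
    have "(x i, y j, a * y j + b) \<in> L" for j
      unfolding L_def by (auto intro!: exI[of _ "y j"])
    then have "B j \<inter> L \<noteq> {}" if "j \<in> K" for j
      using B[OF ab[OF that]] by blast
    then have "real (card {j \<in> {1..m}. B j \<inter> L \<noteq> {}}) \<ge> real m / 6"
      using 1 by (intro count[of m K])
    moreover have "is_line L" unfolding is_line_def L_def
      by (intro exI[of _ "(x i, 0, b)"] exI[of _ "(0, 1, a)"]) (auto simp: zero_prod_def)
    moreover have "L \<subseteq> {(x i, s, t) | s t. True}" unfolding L_def by auto
    ultimately show ?case using 1 by blast
  next
    case (2 j K)
    then obtain a b where ab: "\<And>i. i \<in> K \<Longrightarrow> (a, b) \<in> stabbers {1..m} y x (\<lambda>j i. z i j) j i" by fast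
    define L where "L = {(0::real, y j, b) + t *\<^sub>R (1, 0, a) | t. True}"
    have "(x i, y j, a * x i + b) \<in> L" for i
      unfolding L_def by (auto intro!: exI[of _ "x i"])
    then have "A i \<inter> L \<noteq> {}" if "i \<in> K" for i
      using A[OF ab[OF that]] by blast
    then have "real (card {i \<in> {1..n}. A i \<inter> L \<noteq> {}}) \<ge> real n / 6"
      using 2 by (intro count[of n K])
    moreover have "is_line L" unfolding is_line_def L_def
      by (intro exI[of _ "(0, y j, b)"] exI[of _ "(1, 0, a)"]) (auto simp: zero_prod_def)
    moreover have "L \<subseteq> {(s, y j, t) | s t. True}" unfolding L_def by auto
    ultimately show ?case using 2 by blast
  qed
qed

end
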